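(* Let $\bar x,u_1,u_2\in\mathbb{R}^n$, $\tau>0$, and let $B=\tau I+u_1u_1^T-u_2u_2^T$. For $\alpha=(\alpha_1,\alpha_2)^T\in\mathbb{R}^2$ put $$\zeta(\alpha)=\bar x-\frac{\alpha_1}{\tau}u_1+\alpha_2(\tau I+u_1u_1^T)^{-1}u_2 .$$ Suppose that $u_1$ and $u_2$ are linearly independent, $B$ is positive definite, and $h_1:\mathbb{R}^n\to\mathbb{R}\cup\{\infty\}$ is proper, lower semicontinuous and convex. Define $\mathcal{L}:\mathbb{R}^2\to\mathbb{R}^2$ by $$\mathcal{L}(\alpha)=\begin{pmatrix}u_1^T\big(\bar x+\alpha_2(\tau I+u_1u_1^T)^{-1}u_2-\mathrm{Prox}_{\frac1\tau h_1}(\zeta(\alpha))\big)+\alpha_1\\ u_2^T\big(\bar x-\mathrm{Prox}_{\frac1\tau h_1}(\zeta(\alpha))\big)+\alpha_2\end{pmatrix}.$$ Then the equation $\mathcal{L}(\alpha)=0$ has a unique root $\alpha^\ast\in\mathbb{R}^2$, and $$\mathrm{Prox}^{B}_{h_1}(\bar x)=\mathrm{Prox}_{\frac1\tau h_1}(\zeta(\alpha^\ast)).$$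
   Context: For a symmetric positive definite matrix $A$ and a proper lower semicontinuous convex function $\tilde h$, the scaled proximal mapping is $\mathrm{Prox}_{\tilde h}^{A}(y)=\operatorname{argmin}_{x\in\mathbb{R}^n}\big(\tilde h(x)+\frac12\|x-y\|_A^2\big)$ with $\|x\|_A=\sqrt{x^TAx}$; $\mathrm{Prox}_{\tilde h}=\mathrm{Prox}_{\tilde h}^{I}$. *)

theory Defs
  imports "HOL-Analysis.Analysis"
begin

text \<open>Extended-valued convex functions \<open>\<real>\<^sup>n \<rightarrow> \<real> \<union> {\<infinity>}\<close> are functions into \<^typ>\<open>ereal\<close>;
  \<open>proper_fun\<close> excludes the value \<open>-\<infinity>\<close>.\<close>

definition proper_fun :: "('a \<Rightarrow> ereal) \<Rightarrow> bool" where
  "proper_fun h \<longleftrightarrow> (\<forall>x. h x \<noteq> -\<infinity>) \<and> (\<exists>x. h x \<noteq> \<infinity>)"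

definition lsc_fun :: "('a::topological_space \<Rightarrow> ereal) \<Rightarrow> bool" where
  "lsc_fun h \<longleftrightarrow> (\<forall>x. h x \<le> Liminf (at x) h)"

text \<open>The weight \<open>t\<close> ranges over the open unit interval, so that no product \<open>0 * \<infinity>\<close> occurs.\<close>

definition convex_fun :: "('a::real_vector \<Rightarrow> ereal) \<Rightarrow> bool" where
  "convex_fun h \<longleftrightarrow>
    (\<forall>x y. \<forall>t::real. 0 < t \<and> t < 1 \<longrightarrow>
      h ((1 - t) *\<^sub>R x + t *\<^sub>R y) \<le> ereal (1 - t) * h x + ereal t * h y)"

definition pos_def :: "real^'n^'n \<Rightarrow> bool" where
  "pos_def A \<longleftrightarrow> transpose A = A \<and> (\<forall>x. x \<noteq> 0 \<longrightarrow> 0 < x \<bullet> (A *v x))"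

definition mat_norm :: "real^'n^'n \<Rightarrow> real^'n \<Rightarrow> real" where
  "mat_norm A x = sqrt (x \<bullet> (A *v x))"

text \<open>For positive definite \<open>A\<close> and proper, lower semicontinuous, convex \<open>h\<close> the minimiser exists
  and is unique, so \<^const>\<open>arg_min\<close> picks exactly the argmin.\<close>

definition scaled_prox :: "real^'n^'n \<Rightarrow> (real^'n \<Rightarrow> ereal) \<Rightarrow> real^'n \<Rightarrow> real^'n" where
  "scaled_prox A h y = arg_min (\<lambda>x. h x + ereal (1/2 * (mat_norm A (x - y))\<^sup>2)) (\<lambda>x. True)"

definition prox :: "(real^'n \<Rightarrow> ereal) \<Rightarrow> real^'n \<Rightarrow> real^'n" where
  "prox h = scaled_prox (mat 1) h"

text \<open>The matrix \<open>u v\<^sup>T\<close>.\<close>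

definition outer :: "real^'n \<Rightarrow> real^'n \<Rightarrow> real^'n^'n" where
  "outer u v = (columnvector u :: real^1^'n) ** (rowvector v :: real^'n^1)"

definition zeta :: "real^'n \<Rightarrow> real^'n \<Rightarrow> real^'n \<Rightarrow> real \<Rightarrow> real^2 \<Rightarrow> real^'n" where
  "zeta xbar u1 u2 \<tau> \<alpha> =
    xbar - (\<alpha>$1 / \<tau>) *\<^sub>R u1 + (\<alpha>$2) *\<^sub>R (matrix_inv (\<tau> *\<^sub>R mat 1 + outer u1 u1) *v u2)"

definition root_map ::
  "real^'n \<Rightarrow> real^'n \<Rightarrow> real^'n \<Rightarrow> real \<Rightarrow> (real^'n \<Rightarrow> ereal) \<Rightarrow> real^2 \<Rightarrow> real^2" where
  "root_map xbar u1 u2 \<tau> h \<alpha> =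
    vector
     [u1 \<bullet> (xbar + (\<alpha>$2) *\<^sub>R (matrix_inv (\<tau> *\<^sub>R mat 1 + outer u1 u1) *v u2)
             - prox (\<lambda>x. ereal (1 / \<tau>) * h x) (zeta xbar u1 u2 \<tau> \<alpha>)) + \<alpha>$1,
      u2 \<bullet> (xbar - prox (\<lambda>x. ereal (1 / \<tau>) * h x) (zeta xbar u1 u2 \<tau> \<alpha>)) + \<alpha>$2]"

end

theory Submission
  imports Defs
begin

text \<open>By first-order optimality, \<open>p\<close> is the scaled proximal point of \<open>y\<close> iff \<open>A (y - p)\<close> is a
  subgradient of \<open>h\<close> at \<open>p\<close>. A point \<open>\<alpha>\<close> is a root of \<open>\<L>\<close> iff \<open>\<alpha> = a(p)\<close> for an explicit function
  \<open>a\<close> of \<open>p = prox (\<zeta> \<alpha>)\<close>, and \<open>\<tau> (\<zeta> (a p) - p) = B (xbar - p)\<close> for every \<open>p\<close>. Hence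
  \<open>prox (\<zeta> (a p)) = p\<close> and \<open>scaled_prox B xbar = p\<close> are the same subgradient inclusion, and \<open>\<alpha>\<close> is a
  root iff \<open>\<alpha> = a (scaled_prox B xbar)\<close>.\<close>

section \<open>Lower semicontinuity, attained minima and a linear minorant\<close>

lemma lsc_fun_open_superlevel:
  fixes h :: "'a::topological_space \<Rightarrow> ereal"
  assumes "lsc_fun h"
  shows "open {x. c < h x}"
proof -
  have "\<forall>\<^sub>F y in nhds x. c < h y" if "c < h x" for x
  proof -
    have "c < Liminf (at x) h"
      using that assms unfolding lsc_fun_def by (meson less_le_trans)
    then show ?thesis
      \<comment> \<open>\<open>Liminf (at x)\<close> ignores \<open>x\<close> itself, so the bound
        at the centre enters separately.\<close>
      using that by (auto simp: eventually_nhds_conv_at dest: less_LiminfD)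
  qed
  then show ?thesis
    by (subst open_subopen) (auto simp: eventually_nhds subset_eq)
qed

text \<open>Without a minimiser the strict superlevel sets at points of \<open>K\<close> cover
  \<open>K\<close>. A finite subcover then fails at a point where \<open>f\<close> is least among
  the finitely many indices.\<close>

lemma attains_min_of_open_superlevels:
  fixes f :: "'a::topological_space \<Rightarrow> 'b::linorder"
  assumes K: "compact K" "K \<noteq> {}" and f: "\<And>x. x \<in> K \<Longrightarrow> open {y. f x < f y}"
  shows "\<exists>p\<in>K. \<forall>x\<in>K. f p \<le> f x"
proof (rule ccontr)
  assume "\<not> ?thesis"
  then have "K \<subseteq> (\<Union>z\<in>K. {y. f z < f y})"
    by (auto simp: not_le)
  with K(1) f obtain F where F: "F \<subseteq> K" "finite F" "K \<subseteq> (\<Union>z\<in>F. {y. f z < f y})"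
    by (rule compactE_image)
  with K(2) have "F \<noteq> {}" by auto
  with F(2) obtain z where "z \<in> F" "\<And>y. y \<in> F \<Longrightarrow> f z \<le> f y"
    by (metis arg_min_if_finite(1) arg_min_least)
  with F(1,3) show False
    by fastforce
qed

lemma lsc_fun_add_continuous:
  fixes h :: "'a::topological_space \<Rightarrow> ereal"
  assumes h: "lsc_fun h" and q: "continuous_on UNIV q"
  shows "open {x. ereal c < h x + ereal (q x)}"
proof -
  \<comment> \<open>A real \<open>d\<close> strictly between \<open>c - q x\<close> and
    \<open>h x\<close> separates the conditions on \<open>h\<close> and \<open>q\<close>, each of
    which is open.\<close>
  have "{x. ereal c < h x + ereal (q x)} = (\<Union>d. {x. ereal d < h x} \<inter> {x. c - d < q x})"
    (is "?L = ?R")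
  proof (intro set_eqI iffI)
    fix x assume "x \<in> ?L"
    then have "ereal (c - q x) < h x"
      by (cases "h x") auto
    then obtain d where "ereal (c - q x) < ereal d" "ereal d < h x"
      using ereal_dense2 by blast
    then show "x \<in> ?R" by (auto intro!: exI[of _ d])
  next
    fix x assume "x \<in> ?R"
    then show "x \<in> ?L" by (cases "h x") auto
  qed
  moreover have "open ({x. ereal d < h x} \<inter> {x. c - d < q x})" for d
    by (intro open_Int lsc_fun_open_superlevel[OF h] open_Collect_less q continuous_on_const)
  ultimately show ?thesis by (simp add: open_UN)
qed

text \<open>For \<open>|x - x0| > 1\<close>, convexity along the segment from \<open>x0\<close> to \<open>x\<close> transports the
  minimum of \<open>h\<close> on the unit ball around \<open>x0\<close> to a linear lower bound at \<open>x\<close>.\<close>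

lemma convex_lsc_linear_lower_bound:
  fixes h :: "real^'n \<Rightarrow> ereal"
  assumes "proper_fun h" "lsc_fun h" "convex_fun h" and fin: "h x0 = ereal a"
  shows "\<exists>C. \<forall>x. ereal (- C * (1 + norm (x - x0))) \<le> h x"
proof -
  obtain p where p: "\<And>x. x \<in> cball x0 1 \<Longrightarrow> h p \<le> h x"
    using attains_min_of_open_superlevels[of "cball x0 1" h]
      lsc_fun_open_superlevel[OF assms(2)] by (force simp del: mem_cball)
  have "h p \<noteq> \<infinity>" "h p \<noteq> -\<infinity>"
    using p[of x0] fin assms(1) by (auto simp: proper_fun_def)
  then obtain m where m: "h p = ereal m" by (cases "h p") auto
  have ma: "m \<le> a" using p[of x0] m fin by simp
  \<comment> \<open>Chosen to dominate both \<open>- m\<close> inside the ball and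
    \<open>(r - 1) * a - r * m\<close> at distance \<open>r\<close> outside it.\<close>
  define C where "C = \<bar>m\<bar> + \<bar>a\<bar>"
  have "ereal (- C * (1 + norm (x - x0))) \<le> h x" for x
  proof (cases "norm (x - x0) \<le> 1")
    case True
    have "- C * (1 + norm (x - x0)) \<le> - C * 1"
      unfolding C_def by (intro mult_left_mono_neg) auto
    also have "\<dots> \<le> m" by (simp add: C_def)
    finally have "ereal (- C * (1 + norm (x - x0))) \<le> h p" by (simp add: m)
    also have "\<dots> \<le> h x" using True by (intro p) (simp add: dist_norm norm_minus_commute)
    finally show ?thesis .
  next
    case False
    define r where "r = norm (x - x0)"
    have r: "r > 1" using False by (simp add: r_def)
    \<comment> \<open>The point where the segment from \<open>x0\<close> to \<open>x\<close> leaves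
      the unit ball, so \<open>m \<le> h z\<close>.\<close>
    define z where "z = (1 - 1/r) *\<^sub>R x0 + (1/r) *\<^sub>R x"
    have "z - x0 = (1/r) *\<^sub>R (x - x0)"
      by (simp add: z_def algebra_simps)
    then have "norm (z - x0) = 1"
      using r by (simp add: r_def) (metis norm_zero not_one_less_zero right_minus_eq)
    then have "ereal m \<le> h z"
      using p[of z] m by (simp add: dist_norm norm_minus_commute)
    also have "h z \<le> ereal (1 - 1/r) * h x0 + ereal (1/r) * h x"
      using assms(3) r unfolding convex_fun_def z_def by simp
    finally have ineq: "ereal m \<le> ereal ((1 - 1/r) * a) + ereal (1/r) * h x"
      by (simp add: fin)
    show ?thesis
    proof (cases "h x")
      case (real b)
      have "m \<le> (1 - 1/r) * a + (1/r) * b"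
        using ineq real by simp
      then have "r * m \<le> (r - 1) * a + b"
        using r by (simp add: field_simps)
      moreover have "r * m \<ge> - r * \<bar>m\<bar>"
        using r by (simp add: abs_if)
      moreover have "(r - 1) * a \<le> (r - 1) * \<bar>a\<bar>"
        using r by (intro mult_left_mono) auto
      ultimately have "- C * (1 + r) \<le> b"
        unfolding C_def by (simp add: algebra_simps)
      then show ?thesis by (simp add: real r_def)
    qed (use assms(1) in \<open>auto simp: proper_fun_def\<close>)
  qed
  then show ?thesis by blast
qed

section \<open>Rank-one matrices and positive definite quadratic forms\<close>

lemma outer_vector_mult: "outer u v *v x = (v \<bullet> x) *\<^sub>R u"
  unfolding outer_def matrix_vector_mul_assoc[symmetric]
  by (simp add: vec_eq_iff columnvector_def rowvector_def matrix_vector_mult_def inner_vec_def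
      mult.commute sum_distrib_left)

lemma mat_norm_power2:
  assumes "pos_def A"
  shows "(mat_norm A x)\<^sup>2 = x \<bullet> (A *v x)"
  using assms unfolding pos_def_def mat_norm_def
  by (cases "x = 0") (auto simp: less_imp_le)

lemma pos_def_inner_commute:
  assumes "pos_def A"
  shows "x \<bullet> (A *v y) = y \<bullet> (A *v x)"
  using assms unfolding pos_def_def
  by (metis dot_lmul_matrix inner_commute transpose_matrix_vector)

text \<open>The constant is the minimum of the form on the compact unit sphere; homogeneity carries
  the bound to all vectors.\<close>

lemma pos_def_lower_bound:
  fixes A :: "real^'n^'n"
  assumes "pos_def A"
  obtains c where "c > 0" "\<And>x. c * (norm x)\<^sup>2 \<le> x \<bullet> (A *v x)"
proof -
  have cont: "continuous_on UNIV (\<lambda>x. x \<bullet> (A *v x))"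
    by (intro continuous_intros linear_continuous_on
        linear_conv_bounded_linear[THEN iffD1] matrix_vector_mul_linear)
  have "sphere (0::real^'n) 1 \<noteq> {}"
    using vector_choose_size[of 1] by auto
  then obtain p :: "real^'n" where p: "norm p = 1"
      "\<And>x. norm x = 1 \<Longrightarrow> p \<bullet> (A *v p) \<le> x \<bullet> (A *v x)"
    using continuous_attains_inf[OF compact_sphere _ continuous_on_subset[OF cont], of 0 1]
    by auto
  have "p \<bullet> (A *v p) * (norm x)\<^sup>2 \<le> x \<bullet> (A *v x)" for x
  proof (cases "x = 0")
    case False
    then have "p \<bullet> (A *v p) \<le> (x /\<^sub>R norm x) \<bullet> (A *v (x /\<^sub>R norm x))"
      by (intro p) simp
    also have "\<dots> = (x \<bullet> (A *v x)) / (norm x)\<^sup>2"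
      by (simp add: matrix_vector_mult_scaleR power2_eq_square field_simps)
    finally show ?thesis using False by (simp add: field_simps)
  qed simp
  moreover have "p \<bullet> (A *v p) > 0"
    using assms p(1) unfolding pos_def_def by (metis norm_zero zero_neq_one)
  ultimately show ?thesis using that by blast
qed

lemma pos_def_mat_1: "pos_def (mat 1)"
  by (simp add: pos_def_def)

section \<open>Existence of proximal points\<close>

text \<open>Coercivity: the quadratic term outgrows the linear lower bound of \<open>h\<close>, so a
  minimum over a large enough ball is global.\<close>

lemma scaled_prox_exists:
  fixes h :: "real^'n \<Rightarrow> ereal"
  assumes A: "pos_def A" and h: "proper_fun h" "lsc_fun h" "convex_fun h"
  shows "\<exists>p. \<forall>x. h p + ereal (1/2 * (mat_norm A (p - y))\<^sup>2)
    \<le> h x + ereal (1/2 * (mat_norm A (x - y))\<^sup>2)"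
proof -
  define q where "q x = 1/2 * (mat_norm A (x - y))\<^sup>2" for x
  define f where "f x = h x + ereal (q x)" for x
  have q: "q x = 1/2 * ((x - y) \<bullet> (A *v (x - y)))" for x
    using A by (simp add: q_def mat_norm_power2)
  have "continuous_on UNIV q"
    unfolding q
    by (intro continuous_intros linear_continuous_on_compose[OF _ matrix_vector_mul_linear])
  then have "open {x. ereal c < f x}" for c
    using lsc_fun_add_continuous[OF h(2)] by (simp add: f_def)
  \<comment> \<open>The case \<open>f z = \<infinity>\<close> gives the empty set, and properness
    excludes \<open>-\<infinity>\<close>.\<close>
  then have open_f: "open {x. f z < f x}" for z
    using h(1) by (cases "f z") (auto simp: f_def proper_fun_def)
  obtain x0 a where a: "h x0 = ereal a"
    using h(1) unfolding proper_fun_def by (metis ereal_cases)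
  obtain C where C: "ereal (- C * (1 + norm (x - x0))) \<le> h x" for x
    using convex_lsc_linear_lower_bound[OF h a] by blast
  obtain c where c: "c > 0" "c * (norm x)\<^sup>2 \<le> x \<bullet> (A *v x)" for x
    using pos_def_lower_bound[OF A] by blast
  define d where "d = norm (x0 - y)"
  define M where "M = a + q x0"
  \<comment> \<open>For \<open>s \<ge> 1\<close>, \<open>s * T\<close> bounds the linear loss plus
    \<open>\<bar>M\<bar>\<close>. The choice of \<open>S\<close> ensures
    \<open>T \<le> c / 2 * s\<close> for \<open>s \<ge> S\<close>, so the quadratic term
    wins.\<close>
  define T where "T = \<bar>C\<bar> * (2 + d) + \<bar>M\<bar>"
  define S where "S = 1 + 2 / c * T"
  have "d \<ge> 0" by (simp add: d_def)
  then have "T \<ge> 0" by (simp add: T_def)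
  then have "S \<ge> 1" using c by (simp add: S_def)
  have far: "f x0 \<le> f x" if "norm (x - y) \<ge> S" for x
  proof -
    define s where "s = norm (x - y)"
    have s: "s \<ge> S" "s \<ge> 1" using that \<open>S \<ge> 1\<close> by (auto simp: s_def)
    have "norm (x - x0) \<le> s + d"
      unfolding s_def d_def by norm
    then have "C * (1 + norm (x - x0)) \<le> \<bar>C\<bar> * (1 + (s + d))"
      by (intro mult_mono) auto
    also have "\<dots> + \<bar>M\<bar> \<le> s * T"
    proof -
      have "1 * (\<bar>C\<bar> * (1 + d) + \<bar>M\<bar>) \<le> s * (\<bar>C\<bar> * (1 + d) + \<bar>M\<bar>)"
        using s \<open>d \<ge> 0\<close> by (intro mult_right_mono) auto
      then show ?thesis unfolding T_def by (simp add: algebra_simps)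
    qed
    also have "s * T \<le> s * (c / 2 * s)"
      using s c by (intro mult_left_mono) (auto simp: S_def field_simps)
    also have "\<dots> \<le> q x"
      using c(2)[of "x - y"] by (simp add: q s_def power2_eq_square mult_ac)
    finally have "M \<le> - C * (1 + norm (x - x0)) + q x" by simp
    then have "ereal M \<le> ereal (- C * (1 + norm (x - x0))) + ereal (q x)" by simp
    also have "\<dots> \<le> f x"
      unfolding f_def by (intro add_right_mono C)
    finally show ?thesis by (simp add: f_def M_def a)
  qed
  \<comment> \<open>Enlarging the radius by \<open>d\<close> puts \<open>x0\<close> in the ball, so
    the minimum there is also at most every value outside.\<close>
  have "x0 \<in> cball y (S + d)"
    using \<open>S \<ge> 1\<close> by (simp add: d_def dist_norm norm_minus_commute)
  then obtain p where p: "\<And>x. x \<in> cball y (S + d) \<Longrightarrow> f p \<le> f x"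
    using attains_min_of_open_superlevels[of "cball y (S + d)" f] open_f
    by (metis compact_cball empty_iff)
  have "f p \<le> f x" for x
  proof (cases "x \<in> cball y (S + d)")
    case False
    then have "norm (x - y) \<ge> S"
      using \<open>d \<ge> 0\<close> by (simp add: dist_norm norm_minus_commute)
    then show ?thesis
      using far p[OF \<open>x0 \<in> cball y (S + d)\<close>] order_trans by blast
  qed (rule p)
  then show ?thesis unfolding f_def q_def by blast
qed

section \<open>Subgradients and first-order optimality\<close>

text \<open>Finiteness at \<open>p\<close> excludes \<open>h p = -\<infinity>\<close>, where the
  inequality would hold for every \<open>g\<close>.\<close>

definition is_subgradient :: "('a::real_inner \<Rightarrow> ereal) \<Rightarrow> 'a \<Rightarrow> 'a \<Rightarrow> bool" where
  "is_subgradient h p g \<longleftrightarrow> \<bar>h p\<bar> \<noteq> \<infinity> \<and> (\<forall>x. h p + ereal (g \<bullet> (x - p)) \<le> h x)"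

lemma is_subgradient_scale:
  assumes "is_subgradient h p g" "c > 0"
  shows "is_subgradient (\<lambda>x. ereal c * h x) p (c *\<^sub>R g)"
proof -
  obtain e where e: "h p = ereal e"
    using assms(1) unfolding is_subgradient_def by (cases "h p") auto
  have "ereal (c * e) + ereal (c * (g \<bullet> (x - p))) \<le> ereal c * h x" for x
  proof -
    have "ereal (e + g \<bullet> (x - p)) \<le> h x"
      using assms(1) e unfolding is_subgradient_def by (metis plus_ereal.simps(1))
    then have "ereal c * ereal (e + g \<bullet> (x - p)) \<le> ereal c * h x"
      using assms(2) by (intro ereal_mult_left_mono) auto
    then show ?thesis by (simp add: algebra_simps)
  qed
  then show ?thesis unfolding is_subgradient_def e by simp
qed

lemma is_subgradient_scale_iff:
  assumes "c > 0"
  shows "is_subgradient (\<lambda>x. ereal c * h x) p g \<longleftrightarrow> is_subgradient h p (g /\<^sub>R c)"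
proof
  assume "is_subgradient (\<lambda>x. ereal c * h x) p g"
  from is_subgradient_scale[OF this, of "inverse c"] assms
  show "is_subgradient h p (g /\<^sub>R c)"
    by (simp add: mult.assoc[symmetric] one_ereal_def[symmetric])
next
  assume "is_subgradient h p (g /\<^sub>R c)"
  from is_subgradient_scale[OF this assms] assms
  show "is_subgradient (\<lambda>x. ereal c * h x) p g" by simp
qed

lemma mat_norm_power2_add:
  assumes "pos_def A"
  shows "(mat_norm A (u + v))\<^sup>2 = (mat_norm A u)\<^sup>2 + 2 * ((A *v u) \<bullet> v) + (mat_norm A v)\<^sup>2"
  using pos_def_inner_commute[OF assms, of u v]
  by (simp add: mat_norm_power2[OF assms] matrix_vector_right_distrib inner_add inner_commute)

text \<open>Expanding the quadratic at \<open>p\<close>, the subgradient inequality absorbs the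
  linear term. The remainder \<open>1/2 * (mat_norm A (x - p))\<^sup>2\<close> is positive for
  \<open>x \<noteq> p\<close>, so \<open>p\<close> is the strict minimiser and the only value
  \<open>arg_min\<close> can choose.\<close>

lemma scaled_prox_eqI:
  assumes A: "pos_def A" and sub: "is_subgradient h p (A *v (y - p))"
  shows "scaled_prox A h y = p"
proof -
  define f where "f x = h x + ereal (1/2 * (mat_norm A (x - y))\<^sup>2)" for x
  obtain e where e: "h p = ereal e"
    using sub unfolding is_subgradient_def by (cases "h p") auto
  have less: "f p < f x" if "x \<noteq> p" for x
  proof -
    have "(mat_norm A (x - y))\<^sup>2
        = (mat_norm A (p - y))\<^sup>2 - 2 * ((A *v (y - p)) \<bullet> (x - p)) + (mat_norm A (x - p))\<^sup>2"
      using mat_norm_power2_add[OF A, of "p - y" "x - p"]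
      by (simp add: matrix_vector_mult_diff_distrib inner_diff_left)
    moreover have "(mat_norm A (x - p))\<^sup>2 > 0"
      using A that by (simp add: mat_norm_power2) (simp add: pos_def_def)
    ultimately have "1/2 * (mat_norm A (p - y))\<^sup>2
        < (A *v (y - p)) \<bullet> (x - p) + 1/2 * (mat_norm A (x - y))\<^sup>2"
      by linarith
    then have "ereal (e + 1/2 * (mat_norm A (p - y))\<^sup>2)
        < ereal (e + (A *v (y - p)) \<bullet> (x - p)) + ereal (1/2 * (mat_norm A (x - y))\<^sup>2)"
      by simp
    also have "\<dots> \<le> f x"
      unfolding f_def using sub e
      by (intro add_right_mono) (auto simp: is_subgradient_def)
    finally show ?thesis by (simp add: f_def e)
  qed
  have "arg_min f (\<lambda>x. True) = p"
  proof (rule arg_minI[where x = p])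
    show "\<not> f x < f p" for x
      using less[of x] by (cases "x = p") auto
    show "x = p" if "\<forall>x'. True \<longrightarrow> \<not> f x' < f x" for x
      using less that by blast
  qed simp
  then show ?thesis unfolding scaled_prox_def f_def .
qed

text \<open>Minimality is tested along the segment from \<open>p\<close> to \<open>x\<close>:
  convexity bounds \<open>h\<close> there, and division by \<open>t\<close> followed by
  \<open>t\<close> tending to 0 leaves the first-order inequality.\<close>

lemma is_subgradient_scaled_prox:
  fixes h :: "real^'n \<Rightarrow> ereal"
  assumes A: "pos_def A" and h: "proper_fun h" "lsc_fun h" "convex_fun h"
  shows "is_subgradient h (scaled_prox A h y) (A *v (y - scaled_prox A h y))"
proof -
  define q where "q x = 1/2 * (mat_norm A (x - y))\<^sup>2" for x
  define p where "p = scaled_prox A h y"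
  have min: "h p + ereal (q p) \<le> h x + ereal (q x)" for x
  proof -
    \<comment> \<open>\<open>arg_min\<close> is known to return a minimiser only once some minimiser
      exists.\<close>
    obtain p' where "\<forall>x. h p' + ereal (q p') \<le> h x + ereal (q x)"
      using scaled_prox_exists[OF A h] unfolding q_def by blast
    then have "\<forall>x. h p + ereal (q p) \<le> h x + ereal (q x)"
      unfolding p_def scaled_prox_def q_def[symmetric]
      by (intro arg_minI[of "\<lambda>x. True" p' "\<lambda>x. h x + ereal (q x)"
            "\<lambda>p. \<forall>x. h p + ereal (q p) \<le> h x + ereal (q x)"]) (auto simp: not_less)
    then show ?thesis ..
  qed
  obtain x0 where "h x0 \<noteq> \<infinity>" using h(1) by (auto simp: proper_fun_def)
  then have "h p \<noteq> \<infinity>" using min[of x0] by auto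
  moreover have "h p \<noteq> -\<infinity>" using h(1) by (auto simp: proper_fun_def)
  ultimately obtain e where e: "h p = ereal e" by (cases "h p") auto
  have "h p + ereal ((A *v (y - p)) \<bullet> (x - p)) \<le> h x" for x
  proof (cases "h x")
    case (real b)
    define v where "v = x - p"
    \<comment> \<open>The first-order coefficient of the bound along the segment;
      \<open>0 \<le> k\<close> is the desired inequality rearranged.\<close>
    define k where "k = b - e + (A *v (p - y)) \<bullet> v"
    define Q where "Q = 1/2 * (mat_norm A v)\<^sup>2"
    have "0 \<le> k + t * Q" if t: "0 < t" "t < 1" for t
    proof -
      have z: "(1 - t) *\<^sub>R p + t *\<^sub>R x = p + t *\<^sub>R v"
        by (simp add: v_def algebra_simps)
      have "(mat_norm A (t *\<^sub>R v))\<^sup>2 = t\<^sup>2 * (mat_norm A v)\<^sup>2"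
        unfolding mat_norm_power2[OF A]
        by (simp add: matrix_vector_mult_scaleR power2_eq_square)
      then have "q (p + t *\<^sub>R v) = q p + t * ((A *v (p - y)) \<bullet> v) + t\<^sup>2 * Q"
        using mat_norm_power2_add[OF A, of "p - y" "t *\<^sub>R v"]
        by (simp add: q_def Q_def algebra_simps)
      moreover have "h (p + t *\<^sub>R v) \<le> ereal ((1 - t) * e + t * b)"
        using h(3) t real e unfolding convex_fun_def z[symmetric]
        by (metis times_ereal.simps(1) plus_ereal.simps(1))
      then have "ereal (e + q p) \<le> ereal ((1 - t) * e + t * b) + ereal (q (p + t *\<^sub>R v))"
        using min[of "p + t *\<^sub>R v"] e by (metis add_right_mono order_trans plus_ereal.simps(1))
      ultimately have "0 \<le> t * (k + t * Q)"
        by (simp add: k_def power2_eq_square algebra_simps)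
      then show ?thesis using t by (simp add: zero_le_mult_iff)
    qed
    then have "\<forall>\<^sub>F t in at_right 0. 0 \<le> k + t * Q"
      by (auto simp: eventually_at_right_field intro!: exI[of _ 1])
    moreover have "((\<lambda>t. k + t * Q) \<longlongrightarrow> k + 0 * Q) (at_right 0)"
      by (intro tendsto_intros)
    ultimately have "0 \<le> k"
      using tendsto_lowerbound[of "\<lambda>t. k + t * Q" k "at_right 0" 0] by simp
    then show ?thesis
      using real e by (simp add: k_def v_def matrix_vector_mult_diff_distrib inner_diff_left)
  qed (use h(1) in \<open>auto simp: proper_fun_def\<close>)
  then show ?thesis
    unfolding is_subgradient_def p_def[symmetric] using e by simp
qed

lemma scaled_prox_eq_iff:
  fixes h :: "real^'n \<Rightarrow> ereal"
  assumes "pos_def A" "proper_fun h" "lsc_fun h" "convex_fun h"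
  shows "scaled_prox A h y = p \<longleftrightarrow> is_subgradient h p (A *v (y - p))"
  using scaled_prox_eqI is_subgradient_scaled_prox assms by metis

section \<open>Positive multiples of \<open>h\<close> and the unscaled proximal map\<close>

lemma proper_fun_scale:
  assumes "proper_fun h" "c > 0"
  shows "proper_fun (\<lambda>x. ereal c * h x)"
  using assms by (auto simp: proper_fun_def)

lemma convex_fun_scale:
  assumes "convex_fun h" "c > 0"
  shows "convex_fun (\<lambda>x. ereal c * h x)"
  unfolding convex_fun_def
proof (intro allI impI)
  fix x y and t :: real
  assume t: "0 < t \<and> t < 1"
  then have "ereal c * h ((1 - t) *\<^sub>R x + t *\<^sub>R y) \<le> ereal c * (ereal (1 - t) * h x + ereal t * h y)"
    using assms by (intro ereal_mult_left_mono) (auto simp: convex_fun_def)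
  also have "\<dots> = ereal (1 - t) * (ereal c * h x) + ereal t * (ereal c * h y)"
    using assms(2) by (simp add: ereal_pos_distrib mult_ac)
  finally show "ereal c * h ((1 - t) *\<^sub>R x + t *\<^sub>R y)
      \<le> ereal (1 - t) * (ereal c * h x) + ereal t * (ereal c * h y)" .
qed

lemma lsc_fun_scale:
  fixes h :: "'a::perfect_space \<Rightarrow> ereal"
  assumes "lsc_fun h" "c > 0"
  shows "lsc_fun (\<lambda>x. ereal c * h x)"
  unfolding lsc_fun_def
proof
  fix x
  \<comment> \<open>A continuous monotone map commutes with \<open>Liminf\<close> along a nontrivial
    filter; \<open>perfect_space\<close> makes \<open>at x\<close> nontrivial.\<close>
  have "Liminf (at x) (\<lambda>x. ereal c * h x) = ereal c * Liminf (at x) h"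
    using assms(2)
    by (intro Liminf_compose_continuous_mono)
      (auto simp: mono_def continuous_on_def intro!: ereal_mult_left_mono tendsto_cmult_ereal)
  then show "ereal c * h x \<le> Liminf (at x) (\<lambda>x. ereal c * h x)"
    using assms by (auto simp: lsc_fun_def intro!: ereal_mult_left_mono)
qed

text \<open>For the identity matrix the optimality vector is \<open>z - p\<close>; undoing the
  factor \<open>1 / \<tau>\<close> on \<open>h\<close> multiplies it by
  \<open>\<tau>\<close>.\<close>

lemma prox_scale_eq_iff:
  fixes h :: "real^'n \<Rightarrow> ereal"
  assumes "proper_fun h" "lsc_fun h" "convex_fun h" "\<tau> > 0"
  shows "prox (\<lambda>x. ereal (1 / \<tau>) * h x) z = p \<longleftrightarrow> is_subgradient h p (\<tau> *\<^sub>R (z - p))"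
  unfolding prox_def
  using assms is_subgradient_scale_iff[of "1/\<tau>"]
  by (subst scaled_prox_eq_iff)
    (auto intro!: pos_def_mat_1 proper_fun_scale lsc_fun_scale convex_fun_scale)

section \<open>Inverting the rank-one update of a multiple of the identity\<close>

lemma scaled_mat_1_plus_outer_vector_mult:
  "(\<tau> *\<^sub>R mat 1 + outer u u) *v x = \<tau> *\<^sub>R x + (u \<bullet> x) *\<^sub>R u"
  by (simp add: matrix_vector_mult_add_rdistrib outer_vector_mult scaleR_matrix_vector_assoc[symmetric])

text \<open>Pairing a kernel vector \<open>x\<close> with its image gives
  \<open>\<tau> * (x \<bullet> x) + (u \<bullet> x)\<^sup>2 = 0\<close>, which forces
  \<open>x = 0\<close>.\<close>

lemma invertible_scaled_mat_1_plus_outer: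
  fixes u :: "real^'n"
  assumes "\<tau> > 0"
  shows "invertible (\<tau> *\<^sub>R mat 1 + outer u u)"
  unfolding invertible_left_inverse matrix_left_invertible_ker
proof (intro allI impI)
  fix x
  assume "(\<tau> *\<^sub>R mat 1 + outer u u) *v x = 0"
  then have "(\<tau> *\<^sub>R x + (u \<bullet> x) *\<^sub>R u) \<bullet> x = 0"
    by (simp add: scaled_mat_1_plus_outer_vector_mult)
  then have "\<tau> * (x \<bullet> x) + (u \<bullet> x)\<^sup>2 = 0"
    by (simp add: inner_add_left power2_eq_square)
  with assms show "x = 0"
    by (smt (verit) inner_gt_zero_iff mult_pos_pos zero_le_power2)
qed

lemma matrix_inv_vector_mult:
  fixes A :: "real^'n^'n"
  assumes "invertible A"
  shows "A *v (matrix_inv A *v x) = x"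
  using assms someI_ex[of "\<lambda>A'. A ** A' = mat 1 \<and> A' ** A = mat 1"]
  by (simp add: matrix_vector_mul_assoc matrix_inv_def invertible_def)

section \<open>Roots of the two-dimensional equation\<close>

theorem theorem5:
  fixes xbar u1 u2 :: "real^'n"
    and \<tau> :: real
    and B :: "real^'n^'n"
    and h1 :: "real^'n \<Rightarrow> ereal"
  assumes "\<tau> > 0"
    and "B = \<tau> *\<^sub>R mat 1 + outer u1 u1 - outer u2 u2"
    and "u1 \<noteq> u2" and "independent {u1, u2}"
    and "pos_def B"
    and "proper_fun h1" and "lsc_fun h1" and "convex_fun h1"
  shows "(\<exists>!\<alpha>. root_map xbar u1 u2 \<tau> h1 \<alpha> = 0) \<and>
    (\<forall>\<alpha>. root_map xbar u1 u2 \<tau> h1 \<alpha> = 0 \<longrightarrow>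
      scaled_prox B h1 xbar = prox (\<lambda>x. ereal (1 / \<tau>) * h1 x) (zeta xbar u1 u2 \<tau> \<alpha>))"
proof -
  define w where "w = matrix_inv (\<tau> *\<^sub>R mat 1 + outer u1 u1) *v u2"
  have w: "\<tau> *\<^sub>R w + (u1 \<bullet> w) *\<^sub>R u1 = u2"
    unfolding scaled_mat_1_plus_outer_vector_mult[symmetric] w_def
    by (rule matrix_inv_vector_mult[OF invertible_scaled_mat_1_plus_outer[OF assms(1)]])
  define P where "P \<alpha> = prox (\<lambda>x. ereal (1 / \<tau>) * h1 x) (zeta xbar u1 u2 \<tau> \<alpha>)" for \<alpha>
  \<comment> \<open>Solves the two root equations with the proximal point frozen at
    \<open>p\<close>: the second gives \<open>\<alpha>$2\<close>, and substitution into the first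
    gives \<open>\<alpha>$1\<close>.\<close>
  define a where "a p =
    (vector [- (u1 \<bullet> (xbar - p)) + (u2 \<bullet> (xbar - p)) * (u1 \<bullet> w),
      - (u2 \<bullet> (xbar - p))] :: real^2)" for p
  have root_iff: "root_map xbar u1 u2 \<tau> h1 \<alpha> = 0 \<longleftrightarrow> \<alpha> = a (P \<alpha>)" for \<alpha>
  proof -
    have "root_map xbar u1 u2 \<tau> h1 \<alpha> = 0 \<longleftrightarrow>
        u1 \<bullet> (xbar - P \<alpha>) + \<alpha>$2 * (u1 \<bullet> w) + \<alpha>$1 = 0 \<and> \<alpha>$2 = - (u2 \<bullet> (xbar - P \<alpha>))"
      unfolding root_map_def w_def[symmetric] P_def[symmetric]
      by (auto simp: vec_eq_iff forall_2 inner_add_right inner_diff_right)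
    also have "\<dots> \<longleftrightarrow> \<alpha>$1 = - (u1 \<bullet> (xbar - P \<alpha>)) + (u2 \<bullet> (xbar - P \<alpha>)) * (u1 \<bullet> w)
        \<and> \<alpha>$2 = - (u2 \<bullet> (xbar - P \<alpha>))"
      by auto
    finally show ?thesis by (simp add: a_def vec_eq_iff forall_2)
  qed
  have key: "\<tau> *\<^sub>R (zeta xbar u1 u2 \<tau> (a p) - p) = B *v (xbar - p)" for p
  proof -
    define v where "v = xbar - p"
    have "\<tau> *\<^sub>R (zeta xbar u1 u2 \<tau> (a p) - p)
        = \<tau> *\<^sub>R v - (a p $ 1) *\<^sub>R u1 + (a p $ 2) *\<^sub>R (\<tau> *\<^sub>R w)"
      unfolding zeta_def w_def[symmetric] v_def using assms(1) by (simp add: algebra_simps)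
    \<comment> \<open>Eliminating \<open>\<tau> *\<^sub>R w\<close> leaves a multiple of
      \<open>u1\<close> that cancels the \<open>u1 \<bullet> w\<close> part of
      \<open>a p $ 1\<close>.\<close>
    also have "\<dots> = \<tau> *\<^sub>R v - (a p $ 1) *\<^sub>R u1 + (a p $ 2) *\<^sub>R (u2 - (u1 \<bullet> w) *\<^sub>R u1)"
      by (simp only: eq_diff_eq[THEN iffD2, OF w])
    also have "\<dots> = \<tau> *\<^sub>R v + (u1 \<bullet> v) *\<^sub>R u1 - (u2 \<bullet> v) *\<^sub>R u2"
      by (simp add: a_def v_def[symmetric] algebra_simps)
    also have "\<dots> = B *v v"
      unfolding assms(2) matrix_vector_mult_diff_rdistrib scaled_mat_1_plus_outer_vector_mult
      by (simp add: outer_vector_mult)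
    finally show ?thesis by (simp add: v_def)
  qed
  have prox_iff: "P (a p) = p \<longleftrightarrow> scaled_prox B h1 xbar = p" for p
    unfolding P_def prox_scale_eq_iff[OF assms(6-8,1)] scaled_prox_eq_iff[OF assms(5-8)] key ..
  \<comment> \<open>If \<open>\<alpha> = a (P \<alpha>)\<close>, then \<open>p = P \<alpha>\<close>
    satisfies \<open>P (a p) = p\<close> and is the scaled proximal point. Conversely,
    \<open>P\<close> maps \<open>a (scaled_prox B h1 xbar)\<close> back to that point.\<close>
  have "root_map xbar u1 u2 \<tau> h1 \<alpha> = 0 \<longleftrightarrow> \<alpha> = a (scaled_prox B h1 xbar)" for \<alpha>
    unfolding root_iff using prox_iff by metis
  moreover have "P (a (scaled_prox B h1 xbar)) = scaled_prox B h1 xbar"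
    using prox_iff by blast
  ultimately show ?thesis
    unfolding P_def by auto
qed

end
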